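(* If $\mathcal{S}$ is a $\mathbf{\Delta}^0_2$ graph property, then $G(\mathcal{S})$ is a $\mathbf{\Pi}^0_3$ game, that is, the winning set $A_{\mathcal{S}}$ of Seeker is a $\mathbf{\Pi}^0_3$ subset of $[F]$. In particular, $G(\mathcal{S})$ is determined, that is, one of the two players Seeker and Hider has a winning strategy.
   Context: Let $[\mathbb{N}]^2=\{\{n,k\}: n,k\in\mathbb{N},\ n\neq k\}$. A graph on $\mathbb{N}$ is a subset of $[\mathbb{N}]^2$; identifying graphs with characteristic functions, the space of graphs is $2^{[\mathbb{N}]^2}$ with the product of discrete topologies. A graph property is an isomorphism-invariant subset $\mathcal{S}\subseteq 2^{[\mathbb{N}]^2}$. $\mathbf{\Sigma}^0_n,\mathbf{\Pi}^0_n,\mathbf{\Delta}^0_n$ denote the usual levels of the Borel hierarchy ($\mathbf{\Delta}^0_2$: both $F_\sigma$ and $G_\delta$). The game $G(\mathcal{S})$: in each of $\omega$ many turns, Seeker picks an edge in $[\mathbb{N}]^2$ not picked before and Hider colours it green or red. Formally, let $A=[\mathbb{N}]^2\cup\{\text{green},\text{red}\}$ and let $F\subseteq A^{<\omega}$ be the tree of finite sequences $s$ such that (for all indices below the length of $s$) $s(2i+1)\in\{\text{green},\text{red}\}$, $s(2i)\in[\mathbb{N}]^2$, and $s(2i)\neq s(2j)$ for $i\neq j$. Let $[F]\subseteq A^{\mathbb{N}}$ be the set of infinite branches of $F$ (the runs of the game), with the subspace topology of the product of discrete topologies. For $x\in[F]$ let $G^x=\{e:\exists i\ (x(2i)=e\wedge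 x(2i+1)=\text{green})\}$, $R^x=\{e:\exists i\ (x(2i)=e\wedge x(2i+1)=\text{red})\}$, $W^x=[\mathbb{N}]^2\setminus(G^x\cup R^x)$, and $\mathcal{P}^x=\{G\subseteq[\mathbb{N}]^2: G^x\subseteq G\subseteq G^x\cup W^x\}$. The winning set of Seeker (the player who moves first) is $$A_{\mathcal{S}}=\{x\in[F]: W^x\neq\emptyset\ \wedge\ (\mathcal{P}^x\subseteq\mathcal{S}\ \vee\ \mathcal{P}^x\subseteq 2^{[\mathbb{N}]^2}\setminus\mathcal{S})\};$$ Seeker wins the run $x$ if and only if $x\in A_{\mathcal{S}}$, otherwise Hider wins. *)

theory Defs
  imports "HOL-Analysis.Analysis"
begin

text \<open>
  \<open>sigma0 X n\<close> and \<open>pi0 X n\<close> are meaningful for \<open>n \<ge> 1\<close>: the \<open>\<Sigma>\<^sup>0\<^sub>1\<close> sets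
  are the open sets, and for \<open>n > 1\<close> a set is \<open>\<Sigma>\<^sup>0\<^sub>n\<close> if it is a union
  of a sequence of sets \<open>A i\<close>, each of which is \<open>\<Pi>\<^sup>0\<^sub>m\<close> for some \<open>1 \<le> m < n\<close>
  depending on \<open>i\<close>, i.e.\ has a \<open>\<Sigma>\<^sup>0\<^sub>m\<close> complement.
\<close>

inductive sigma0 :: "'a topology \<Rightarrow> nat \<Rightarrow> 'a set \<Rightarrow> bool" for X where
  sigma0_open: "openin X U \<Longrightarrow> sigma0 X 1 U"
| sigma0_Union: "\<lbrakk>1 < n;
      \<forall>i. 1 \<le> m i \<and> m i < n \<and> A i \<subseteq> topspace X \<and> sigma0 X (m i) (topspace X - A i)\<rbrakk>
    \<Longrightarrow> sigma0 X n (\<Union>i::nat. A i)"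

definition pi0 :: "'a topology \<Rightarrow> nat \<Rightarrow> 'a set \<Rightarrow> bool" where
  "pi0 X n B \<longleftrightarrow> B \<subseteq> topspace X \<and> sigma0 X n (topspace X - B)"

definition delta0 :: "'a topology \<Rightarrow> nat \<Rightarrow> 'a set \<Rightarrow> bool" where
  "delta0 X n B \<longleftrightarrow> sigma0 X n B \<and> pi0 X n B"

text \<open>The second level agrees with the library notions of \<open>F\<^sub>\<sigma>\<close> and \<open>G\<^sub>\<delta>\<close> sets.\<close>

lemma sigma0_1_iff: "sigma0 X 1 U \<longleftrightarrow> openin X U"
  by (auto intro: sigma0_open[simplified] elim: sigma0.cases)

lemma sigma0_2_iff: "sigma0 X 2 B \<longleftrightarrow> fsigma_in X B"
proof
  assume "sigma0 X 2 B"
  then show "fsigma_in X B"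
  proof cases
    case (sigma0_Union m A)
    have "closedin X (A i)" for i
    proof -
      have "m i = 1"
        using sigma0_Union(3)[rule_format, of i] by linarith
      then have "sigma0 X 1 (topspace X - A i)" "A i \<subseteq> topspace X"
        using sigma0_Union(3) by metis+
      then show ?thesis
        unfolding sigma0_1_iff closedin_def by blast
    qed
    then show ?thesis
      unfolding sigma0_Union(1)
      by (intro fsigma_in_Union) (auto intro: closed_imp_fsigma_in)
  qed simp
next
  assume "fsigma_in X B"
  then obtain \<U> where U: "countable \<U>" "\<U> \<subseteq> Collect (closedin X)" "\<Union>\<U> = B"
    unfolding fsigma_in_def union_of_def by auto
  define A where "A = from_nat_into (insert {} \<U>)"
  have r: "range A = insert {} \<U>"
    unfolding A_def using U(1) by (simp add: range_from_nat_into)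
  have c: "closedin X (A i)" for i
    using r U(2) by (metis CollectD closedin_empty insertE rangeI subsetD)
  have "sigma0 X 2 (\<Union>i. A i)"
    using c by (intro sigma0_Union[where m = "\<lambda>_. 1"]) (simp_all only: sigma0_1_iff, auto simp: closedin_def)
  moreover have "(\<Union>i. A i) = B"
    using r U(3) by auto
  ultimately show "sigma0 X 2 B" by simp
qed

lemma pi0_2_iff: "pi0 X 2 B \<longleftrightarrow> gdelta_in X B"
  by (simp add: pi0_def sigma0_2_iff gdelta_in_fsigma_in)

definition edges :: "nat set set" where
  "edges = {{n, k} | n k. n \<noteq> k}"

text \<open>
  The space \<open>2\<^bsup>edges\<^esup>\<close>, carried by the set of all subsets of \<open>edges\<close>: each graph
  is identified with its characteristic function on \<open>edges\<close>.
\<close>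

definition graph_space :: "nat set set topology" where
  "graph_space = pullback_topology (Pow edges) (\<lambda>G. restrict (\<lambda>e. e \<in> G) edges)
     (product_topology (\<lambda>_. discrete_topology (UNIV :: bool set)) edges)"

definition graph_isomorphic :: "nat set set \<Rightarrow> nat set set \<Rightarrow> bool" where
  "graph_isomorphic G H \<longleftrightarrow>
     (\<exists>\<pi> :: nat \<Rightarrow> nat. bij \<pi> \<and> (\<forall>n k. n \<noteq> k \<longrightarrow> ({n, k} \<in> G \<longleftrightarrow> {\<pi> n, \<pi> k} \<in> H)))"

definition graph_property :: "nat set set set \<Rightarrow> bool" where
  "graph_property S \<longleftrightarrow> S \<subseteq> Pow edges \<and>
     (\<forall>G\<in>Pow edges. \<forall>H\<in>Pow edges. graph_isomorphic G H \<longrightarrow> (G \<in> S \<longleftrightarrow> H \<in> S))"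

definition initial_segment :: "(nat \<Rightarrow> 'm) \<Rightarrow> nat \<Rightarrow> 'm list" where
  "initial_segment x n = map x [0..<n]"

definition branches :: "'m list set \<Rightarrow> (nat \<Rightarrow> 'm) set" where
  "branches T = {x. \<forall>n. initial_segment x n \<in> T}"

text \<open>
  The parity \<open>p\<close> stands for the player who moves at the positions \<open>s\<close> with
  \<open>length s mod 2 = p\<close>: 0 for the player who moves first, 1 for the other one.
\<close>

definition strategy :: "'m list set \<Rightarrow> nat \<Rightarrow> ('m list \<Rightarrow> 'm) \<Rightarrow> bool" where
  "strategy T p \<sigma> \<longleftrightarrow> (\<forall>s\<in>T. length s mod 2 = p \<longrightarrow> s @ [\<sigma> s] \<in> T)"

definition follows :: "nat \<Rightarrow> ('m list \<Rightarrow> 'm) \<Rightarrow> (nat \<Rightarrow> 'm) \<Rightarrow> bool" where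
  "follows p \<sigma> x \<longleftrightarrow> (\<forall>n. n mod 2 = p \<longrightarrow> x n = \<sigma> (initial_segment x n))"

definition winning_strategy ::
  "'m list set \<Rightarrow> nat \<Rightarrow> (nat \<Rightarrow> 'm) set \<Rightarrow> ('m list \<Rightarrow> 'm) \<Rightarrow> bool" where
  "winning_strategy T p Win \<sigma> \<longleftrightarrow>
     strategy T p \<sigma> \<and> (\<forall>x\<in>branches T. follows p \<sigma> x \<longrightarrow> x \<in> Win)"

text \<open>\<open>Win\<close> is the set of runs won by the player who moves first.\<close>

definition determined :: "'m list set \<Rightarrow> (nat \<Rightarrow> 'm) set \<Rightarrow> bool" where
  "determined T Win \<longleftrightarrow>
     (\<exists>\<sigma>. winning_strategy T 0 Win \<sigma>) \<or> (\<exists>\<tau>. winning_strategy T 1 (branches T - Win) \<tau>)"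

datatype colour = Green | Red

datatype move = Edge "nat set" | Colour colour

definition moves :: "move set" where
  "moves = Edge ` edges \<union> range Colour"

definition game_tree :: "move list set" where
  "game_tree = {s \<in> lists moves.
     (\<forall>i. 2 * i + 1 < length s \<longrightarrow> s ! (2 * i + 1) \<in> range Colour) \<and>
     (\<forall>i. 2 * i < length s \<longrightarrow> s ! (2 * i) \<in> Edge ` edges) \<and>
     (\<forall>i j. 2 * i < length s \<and> 2 * j < length s \<and> i \<noteq> j \<longrightarrow> s ! (2 * i) \<noteq> s ! (2 * j))}"

abbreviation runs :: "(nat \<Rightarrow> move) set" where
  "runs \<equiv> branches game_tree"

definition run_space :: "(nat \<Rightarrow> move) topology" where
  "run_space = subtopology (product_topology (\<lambda>_. discrete_topology moves) UNIV) runs"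

definition green_edges :: "(nat \<Rightarrow> move) \<Rightarrow> nat set set" where
  "green_edges x = {e. \<exists>i. x (2 * i) = Edge e \<and> x (2 * i + 1) = Colour Green}"

definition red_edges :: "(nat \<Rightarrow> move) \<Rightarrow> nat set set" where
  "red_edges x = {e. \<exists>i. x (2 * i) = Edge e \<and> x (2 * i + 1) = Colour Red}"

definition white_edges :: "(nat \<Rightarrow> move) \<Rightarrow> nat set set" where
  "white_edges x = edges - (green_edges x \<union> red_edges x)"

definition possible_graphs :: "(nat \<Rightarrow> move) \<Rightarrow> nat set set set" where
  "possible_graphs x =
     {G. G \<subseteq> edges \<and> green_edges x \<subseteq> G \<and> G \<subseteq> green_edges x \<union> white_edges x}"

definition seeker_wins :: "nat set set set \<Rightarrow> (nat \<Rightarrow> move) set" where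
  "seeker_wins S = {x \<in> runs. white_edges x \<noteq> {} \<and>
     (possible_graphs x \<subseteq> S \<or> possible_graphs x \<subseteq> Pow edges - S)}"

end

theory Submission
  imports Defs
begin

text \<open>
A run is won by Seeker if some edge stays unpicked forever and the possible graphs all agree
on \<open>S\<close>. Both conditions can be read off from events that happen along the run.

An edge stays unpicked iff it is not the case that every edge is picked at some time. For the
second condition, write the \<open>G\<^sub>\<delta>\<close> set \<open>S\<close> as an intersection of open sets \<open>U k\<close>. The graphs
compatible with the first \<open>n\<close> moves form a decreasing sequence of closed sets whose intersection
is the set of possible graphs, so by compactness of \<open>2\<^bsup>edges\<^esup>\<close> the possible graphs lie in \<open>U k\<close>
iff those compatible with some initial segment do (\<open>possible_graphs_subset_open_iff\<close>). Hence
"all possible graphs lie in \<open>S\<close>" says that for every \<open>k\<close> some initial segment has a certain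
property, and likewise for the complement of \<open>S\<close>, which is \<open>G\<^sub>\<delta>\<close> too.
A counter that waits for the property number \<open>0\<close>, then number \<open>1\<close>, and so on, turns every such
statement into "an event happens infinitely often" (\<open>infinitely_often_event\<close>), and a union of
two such conditions is again of this kind. So there are sets \<open>a\<close> and \<open>b\<close> of positions such
that Seeker wins iff \<open>a\<close> is visited finitely often and \<open>b\<close> infinitely often
(\<open>seeker_wins_events\<close>). This is the intersection of an \<open>F\<^sub>\<sigma>\<close> and a \<open>G\<^sub>\<delta>\<close> set, hence \<open>\<Pi>\<^sup>0\<^sub>3\<close>.

It is also a parity condition with three priorities: visiting \<open>a\<close> is bad for Seeker, visiting \<open>b\<close>
is good but outweighed by \<open>a\<close>, and visiting neither is bad but outweighed by \<open>b\<close>. So determinacy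
follows from the fixed-point characterisation of the winning regions of parity games
(\<open>three_event_game_determined\<close>). Seeker's region is
\<open>\<mu>X. \<nu>Y. \<mu>Z.\<close> of "Seeker can force the next position to lie in \<open>X\<close>, \<open>Y\<close> or \<open>Z\<close>, according to
the event there", and the complement is the dual fixed point for Hider. In either case the
transfinite stages of the least fixed points give ranks that the owner of the region can keep
from increasing (Hider only between two visits to \<open>a\<close>), and the well-foundedness of the ranks
shows that the resulting play is won.
\<close>


section \<open>Initial segments\<close>

lemma initial_segment_Suc: "initial_segment x (Suc n) = initial_segment x n @ [x n]"
  by (simp add: initial_segment_def)

lemma length_initial_segment [simp]: "length (initial_segment x n) = n"
  by (simp add: initial_segment_def)

lemma nth_initial_segment [simp]: "i < n \<Longrightarrow> initial_segment x n ! i = x i"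
  by (simp add: initial_segment_def)

lemma take_initial_segment: "i \<le> n \<Longrightarrow> take i (initial_segment x n) = initial_segment x i"
  by (simp add: initial_segment_def take_map)

section \<open>Transfinite stages of a least fixed point\<close>

text \<open>
The transfinite iterates of \<open>f\<close> from the empty set, with successor and limit stages generated
by a single rule: taking \<open>M = {C}\<close> gives \<open>f C\<close>, and unions of stages are obtained because every
stage is itself a union of sets \<open>f C\<close>.
\<close>
inductive_set stages :: "('a set \<Rightarrow> 'a set) \<Rightarrow> 'a set set" for f where
  Union_image: "\<forall>C\<in>M. C \<in> stages f \<Longrightarrow> (\<Union>C\<in>M. f C) \<in> stages f"

lemma stages_step:
  assumes "C \<in> stages f"
  shows "f C \<in> stages f"
  using stages.intros[of "{C}" f] assms by simp

lemma stages_Union: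
  assumes "M \<subseteq> stages f"
  shows "\<Union>M \<in> stages f"
proof -
  have "\<exists>N. (\<forall>D\<in>N. D \<in> stages f) \<and> C = (\<Union>D\<in>N. f D)" if "C \<in> M" for C
    using that assms by (metis stages.cases subsetD)
  then obtain N where N: "\<And>C. C \<in> M \<Longrightarrow> (\<forall>D\<in>N C. D \<in> stages f) \<and> C = (\<Union>D\<in>N C. f D)"
    by metis
  have "\<Union>M = (\<Union>D\<in>(\<Union>C\<in>M. N C). f D)"
    using N by (auto; metis UN_iff)
  then show ?thesis
    using stages.intros[of "\<Union>C\<in>M. N C" f] N by auto
qed

lemma stages_subset_lfp:
  assumes "mono f" "C \<in> stages f"
  shows "C \<subseteq> lfp f"
  using assms(2)
proof induction
  case (Union_image M)
  have "f C \<subseteq> lfp f" if "C \<in> M" for C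
    using monoD[OF assms(1), of C "lfp f"] Union_image that lfp_unfold[OF assms(1)] by auto
  then show ?case by auto
qed

lemma stages_increasing:
  assumes "mono f" "C \<in> stages f"
  shows "C \<subseteq> f C"
  using assms(2)
proof induction
  case (Union_image M)
  have "f C \<subseteq> f (\<Union>C\<in>M. f C)" if "C \<in> M" for C
    using Union_image that by (intro monoD[OF assms(1)]) blast
  then show ?case by auto
qed

text \<open>
Nothing lies strictly between a stage and its successor. With \<open>D = (\<Union>X\<in>M. f X)\<close>, if some
\<open>f X\<close> is not contained in \<open>C\<close>, then \<open>C \<subseteq> X\<close> must follow, which is the same claim for the
pair \<open>C, X\<close>. Unfolding \<open>C\<close> in turn leads back to the induction hypothesis for \<open>X\<close>.
\<close>
lemma stages_compare:
  assumes f: "mono f" and D: "D \<in> stages f" and C: "C \<in> stages f"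
  shows "D \<subseteq> C \<or> f C \<subseteq> D"
  using D C
proof (induction arbitrary: C)
  case (Union_image M)
  have swapped: "C \<subseteq> X \<or> f X \<subseteq> C" if "X \<in> M" for X
  proof (rule stages.cases[OF \<open>C \<in> stages f\<close>])
    fix N assume N: "C = (\<Union>Y\<in>N. f Y)" "\<forall>Y\<in>N. Y \<in> stages f"
    show ?thesis
    proof (cases "\<forall>Y\<in>N. f Y \<subseteq> X")
      case False
      then obtain Y where "Y \<in> N" "\<not> f Y \<subseteq> X" by auto
      then have "X \<subseteq> Y" using Union_image.IH that N(2) by blast
      then have "f X \<subseteq> f Y" by (rule monoD[OF f])
      then show ?thesis using N(1) \<open>Y \<in> N\<close> by blast
    qed (use N(1) in blast)
  qed
  show ?case
  proof (cases "\<forall>X\<in>M. f X \<subseteq> C")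
    case False
    then obtain X where "X \<in> M" "\<not> f X \<subseteq> C" by auto
    then have "f C \<subseteq> f X" using swapped by (intro monoD[OF f]) blast
    then show ?thesis using \<open>X \<in> M\<close> by blast
  qed blast
qed

text \<open>
The union \<open>L\<close> of all stages below every member of a family of stages is itself a stage. If it
were not in the family, all members would contain \<open>f L\<close>, so \<open>L\<close> would be closed under \<open>f\<close> and
hence contain the least fixed point, leaving no room for the members.
\<close>
lemma stages_wf:
  assumes f: "mono f"
  shows "wf {(C, D). C \<subset> D \<and> C \<in> stages f \<and> D \<in> stages f}"
proof (rule wfI_min)
  fix Q0 :: "'a set" and \<Q> :: "'a set set"
  assume "Q0 \<in> \<Q>"
  define \<R> where "\<R> = \<Q> \<inter> stages f"
  define L where "L = \<Union>{C \<in> stages f. \<forall>Q\<in>\<R>. C \<subseteq> Q}"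
  have L: "L \<in> stages f" unfolding L_def by (rule stages_Union) auto
  have below: "L \<subseteq> Q" if "Q \<in> \<R>" for Q using that by (auto simp: L_def)
  have "L \<in> \<R>" if nonempty: "\<R> \<noteq> {}"
  proof (rule ccontr)
    assume "L \<notin> \<R>"
    have "f L \<subseteq> Q" if "Q \<in> \<R>" for Q
      using stages_compare[OF f _ L, of Q] below[OF that] that \<open>L \<notin> \<R>\<close>
      by (auto simp: \<R>_def)
    then have "f L \<subseteq> L" unfolding L_def using stages_step[OF L, unfolded L_def] by blast
    then have "lfp f \<subseteq> L" by (rule lfp_lowerbound)
    moreover obtain Q where "Q \<in> \<R>" using nonempty by auto
    ultimately have "Q = L"
      using stages_subset_lfp[OF f, of Q] below[of Q] by (auto simp: \<R>_def)
    then show False using \<open>Q \<in> \<R>\<close> \<open>L \<notin> \<R>\<close> by simp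
  qed
  then show "\<exists>z\<in>\<Q>. \<forall>y. (y, z) \<in> {(C, D). C \<subset> D \<and> C \<in> stages f \<and> D \<in> stages f} \<longrightarrow> y \<notin> \<Q>"
    using below \<open>Q0 \<in> \<Q>\<close> unfolding \<R>_def by (cases "\<Q> \<inter> stages f = {}") (auto; blast)+
qed

text \<open>
The rank of a point is the last stage that it has not entered. Stages play the part of ordinals,
compared by inclusion.
\<close>
definition lfp_rank :: "('a set \<Rightarrow> 'a set) \<Rightarrow> 'a \<Rightarrow> 'a set" where
  "lfp_rank f x = \<Union>{C \<in> stages f. x \<notin> C}"

lemma lfp_rank_in_stages: "lfp_rank f x \<in> stages f"
  unfolding lfp_rank_def by (rule stages_Union) auto

lemma not_in_lfp_rank: "x \<notin> lfp_rank f x"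
  by (auto simp: lfp_rank_def)

text \<open>
If \<open>x\<close> did not enter at the stage after its rank, that stage would be contained in the rank, which
would then be closed under \<open>f\<close> and contain the least fixed point, \<open>x\<close> included.
\<close>
lemma in_step_lfp_rank:
  assumes "mono f" "x \<in> lfp f"
  shows "x \<in> f (lfp_rank f x)"
proof (rule ccontr)
  assume "x \<notin> f (lfp_rank f x)"
  then have "f (lfp_rank f x) \<subseteq> lfp_rank f x"
    using stages_step[OF lfp_rank_in_stages, of f x] by (auto simp: lfp_rank_def)
  then have "lfp f \<subseteq> lfp_rank f x" by (rule lfp_lowerbound)
  then show False using assms(2) not_in_lfp_rank by fast
qed

lemma lfp_rank_step:
  assumes "mono f" "y \<in> f (lfp_rank f x)"
  shows "lfp_rank f y \<subseteq> lfp_rank f x"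
  using stages_compare[OF assms(1) lfp_rank_in_stages lfp_rank_in_stages, of y x]
    assms(2) not_in_lfp_rank
  by fast

lemma lfp_rank_less:
  assumes "mono f" "y \<in> lfp_rank f x"
  shows "lfp_rank f y \<subset> lfp_rank f x"
  using lfp_rank_step[OF assms(1), of y x] stages_increasing[OF assms(1) lfp_rank_in_stages, of x]
    assms(2) not_in_lfp_rank by fast

text \<open>
This is the way in which well-foundedness decides infinite plays: a rank that never increases
after finitely many moves is eventually constant.
\<close>
lemma lfp_rank_eventually_constant:
  fixes s :: "nat \<Rightarrow> 'a"
  assumes f: "mono f" and dec: "\<forall>\<^sub>\<infinity>n. lfp_rank f (s (Suc n)) \<subseteq> lfp_rank f (s n)"
  obtains C where "\<forall>\<^sub>\<infinity>n. lfp_rank f (s n) = C"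
proof -
  obtain N where N: "\<And>n. n \<ge> N \<Longrightarrow> lfp_rank f (s (Suc n)) \<subseteq> lfp_rank f (s n)"
    using dec by (auto simp: MOST_nat_le)
  obtain C where C: "C \<in> {lfp_rank f (s n) | n. n \<ge> N}"
    and min: "\<And>D. D \<subset> C \<Longrightarrow> D \<in> stages f \<Longrightarrow> C \<in> stages f \<Longrightarrow> D \<notin> {lfp_rank f (s n) | n. n \<ge> N}"
    by (rule wfE_min[OF stages_wf[OF f], of "lfp_rank f (s N)" "{lfp_rank f (s n) | n. n \<ge> N}"])
      auto
  obtain n0 where n0: "n0 \<ge> N" "C = lfp_rank f (s n0)" using C by auto
  have "lfp_rank f (s n) \<subseteq> C" if "n \<ge> n0" for n
    using that
  proof (induction rule: dec_induct)
    case (step n)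
    then show ?case using N[of n] n0(1) by auto
  qed (simp add: n0)
  then have "lfp_rank f (s n) = C" if "n \<ge> n0" for n
    using min[of "lfp_rank f (s n)"] that n0 lfp_rank_in_stages by force
  then have "\<forall>\<^sub>\<infinity>n. lfp_rank f (s n) = C" by (auto simp: MOST_nat_le)
  then show ?thesis by (rule that)
qed

section \<open>Determinacy when winning depends on two recurring events\<close>

text \<open>
The positions from which the player \<open>p\<close> can force the next position into \<open>X\<close>. Positions outside
\<open>T\<close> are not excluded, so that the sets for the two players are exact complements.
\<close>
definition controllable :: "'m list set \<Rightarrow> nat \<Rightarrow> 'm list set \<Rightarrow> 'm list set" where
  "controllable T p X = {s. if length s mod 2 = p then \<exists>m. s @ [m] \<in> T \<and> s @ [m] \<in> X
     else \<forall>m. s @ [m] \<in> T \<longrightarrow> s @ [m] \<in> X}"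

text \<open>
The target sets \<open>X\<close>, \<open>Y\<close>, \<open>Z\<close> belong to the priorities of a parity game: the event \<open>a\<close> takes
precedence over \<open>b\<close>.
\<close>
definition by_event :: "('m list \<Rightarrow> bool) \<Rightarrow> ('m list \<Rightarrow> bool) \<Rightarrow>
    'm list set \<Rightarrow> 'm list set \<Rightarrow> 'm list set \<Rightarrow> 'm list set" where
  "by_event a b X Y Z = {t. if a t then t \<in> X else if b t then t \<in> Y else t \<in> Z}"

lemma controllable_mono: "X \<subseteq> Y \<Longrightarrow> controllable T p X \<subseteq> controllable T p Y"
  by (auto simp: controllable_def split: if_splits)

lemma by_event_mono:
  "X \<subseteq> X' \<Longrightarrow> Y \<subseteq> Y' \<Longrightarrow> Z \<subseteq> Z' \<Longrightarrow> by_event a b X Y Z \<subseteq> by_event a b X' Y' Z'"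
  by (auto simp: by_event_def split: if_splits)

lemma Compl_controllable: "- controllable T 0 X = controllable T 1 (- X)"
  by (auto simp: controllable_def split: if_splits)

lemma Compl_by_event: "- by_event a b X Y Z = by_event a b (- X) (- Y) (- Z)"
  by (auto simp: by_event_def split: if_splits)

lemma Compl_lfp: "- lfp f = gfp (\<lambda>X. - f (- X :: 'a set))"
proof -
  have "{u. u \<subseteq> - f (- u)} = uminus ` {u. f u \<subseteq> u}"
    by (auto simp: image_iff intro: exI[of _ "- _"])
  then show ?thesis unfolding lfp_def gfp_def by auto
qed

lemma Compl_gfp: "- gfp f = lfp (\<lambda>X. - f (- X :: 'a set))"
  using Compl_lfp[of "\<lambda>X. - f (- X)"] by auto

text \<open>
A relation that a player can maintain locally becomes a strategy by choosing a suitable move at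
each position; the opponent cannot break it either. Since \<open>[]\<close> is in \<open>W\<close>, the play never
leaves \<open>W\<close>.
\<close>
lemma strategy_for_step_relation:
  assumes pruned: "\<And>s. s \<in> T \<Longrightarrow> \<exists>m. s @ [m] \<in> T"
    and root: "[] \<in> W"
    and step: "\<And>s. s \<in> W \<Longrightarrow> s \<in> controllable T p {t \<in> W. R s t}"
  shows "\<exists>\<sigma>. strategy T p \<sigma> \<and> (\<forall>x\<in>branches T. follows p \<sigma> x \<longrightarrow>
    (\<forall>n. initial_segment x n \<in> W \<and> R (initial_segment x n) (initial_segment x (Suc n))))"
proof -
  define \<sigma> where "\<sigma> = (\<lambda>s. SOME m. s @ [m] \<in> T \<and>
    (s \<in> W \<longrightarrow> s @ [m] \<in> W \<and> R s (s @ [m])))"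
  have \<sigma>: "s @ [\<sigma> s] \<in> T \<and> (s \<in> W \<longrightarrow> s @ [\<sigma> s] \<in> W \<and> R s (s @ [\<sigma> s]))"
    if "s \<in> T" "length s mod 2 = p" for s
    unfolding \<sigma>_def
  proof (rule someI_ex)
    show "\<exists>m. s @ [m] \<in> T \<and> (s \<in> W \<longrightarrow> s @ [m] \<in> W \<and> R s (s @ [m]))"
      using pruned[OF that(1)] step[of s] that(2) by (cases "s \<in> W") (auto simp: controllable_def)
  qed
  show ?thesis
  proof (intro exI[of _ \<sigma>] conjI ballI impI allI)
    show "strategy T p \<sigma>" using \<sigma> by (simp add: strategy_def)
    fix x n assume x: "x \<in> branches T" "follows p \<sigma> x"
    have pos: "initial_segment x n \<in> T" for n
      using x(1) by (simp add: branches_def)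
    have next_step: "initial_segment x (Suc n) \<in> W \<and>
        R (initial_segment x n) (initial_segment x (Suc n))"
      if W: "initial_segment x n \<in> W" for n
    proof (cases "n mod 2 = p")
      case True
      then have "x n = \<sigma> (initial_segment x n)" using x(2) by (simp add: follows_def)
      then show ?thesis using \<sigma>[of "initial_segment x n"] pos W True
        by (simp add: initial_segment_Suc)
    next
      case False
      then show ?thesis using step[OF W] pos[of "Suc n"]
        by (auto simp: controllable_def initial_segment_Suc)
    qed
    have "initial_segment x n \<in> W" for n
      by (induction n) (use root next_step in \<open>auto simp: initial_segment_def\<close>)
    then show "initial_segment x n \<in> W" "R (initial_segment x n) (initial_segment x (Suc n))"
      using next_step by blast+
  qed
qed

text \<open>
The region of the first player is \<open>\<mu>X. \<nu>Y. \<mu>Z. F 0 X Y Z\<close>. From there the first player can move so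
that the rank for \<open>X\<close> never increases and drops at every \<open>a\<close>; so \<open>a\<close> happens finitely often and
this rank stabilises. Once it has, the inner rank for \<open>Z\<close> drops at every move without \<open>b\<close>, so
\<open>b\<close> must recur. The complement is \<open>\<nu>X. \<mu>Y. \<nu>Z. F 1 X Y Z\<close>. There the second player can ensure
that between two occurrences of \<open>a\<close> the rank for \<open>Y\<close> never increases and drops at every \<open>b\<close>;
so if \<open>a\<close> happens finitely often, then so does \<open>b\<close>.
\<close>
theorem three_event_game_determined:
  assumes pruned: "\<And>s. s \<in> T \<Longrightarrow> \<exists>m. s @ [m] \<in> T"
  shows "determined T {x \<in> branches T.
    (\<forall>\<^sub>\<infinity>n. \<not> a (initial_segment x n)) \<and> (\<exists>\<^sub>\<infinity>n. b (initial_segment x n))}"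
    (is "determined T ?Win")
proof -
  define F where "F = (\<lambda>p X Y Z. controllable T p (by_event a b X Y Z))"
  have F_mono: "F p X Y Z \<subseteq> F p X' Y' Z'" if "X \<subseteq> X'" "Y \<subseteq> Y'" "Z \<subseteq> Z'" for p X Y Z X' Y' Z'
    unfolding F_def by (intro controllable_mono by_event_mono that)
  have Compl_F: "- F 0 X Y Z = F 1 (- X) (- Y) (- Z)" for X Y Z
    by (simp add: F_def Compl_controllable Compl_by_event)
  show ?thesis
  proof (cases "[] \<in> lfp (\<lambda>X. gfp (\<lambda>Y. lfp (\<lambda>Z. F 0 X Y Z)))")
    case True
    define g where "g = (\<lambda>X. gfp (\<lambda>Y. lfp (\<lambda>Z. F 0 X Y Z)))"
    define h where "h = (\<lambda>X Z. F 0 X (g X) Z)"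
    define W where "W = lfp g"
    have mono_lfp: "mono (\<lambda>Y. lfp (\<lambda>Z. F 0 X Y Z))" for X
      by (intro monoI lfp_mono F_mono) auto
    have g: "mono g" unfolding g_def
      by (intro monoI gfp_mono lfp_mono F_mono) auto
    have h: "mono (h X)" for X unfolding h_def by (intro monoI F_mono) auto
    have g_lfp: "g X = lfp (h X)" for X
      using gfp_unfold[OF mono_lfp, of X] by (simp add: g_def h_def)
    have W: "g (lfp_rank g s) \<subseteq> W" for s
      using monoD[OF g stages_subset_lfp[OF g lfp_rank_in_stages], of s] lfp_unfold[OF g]
      by (simp add: W_def)
    \<comment> \<open>The inner rank refers to the function \<open>h (lfp_rank g s)\<close>, which changes with \<open>s\<close> until the
      outer rank is constant; only from then on are inner ranks compared.\<close>
    define R where "R = (\<lambda>s t. if a t then lfp_rank g t \<subset> lfp_rank g s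
      else lfp_rank g t \<subseteq> lfp_rank g s \<and> (b t \<or> t \<in> lfp_rank (h (lfp_rank g s)) s))"
    have "\<exists>\<sigma>. strategy T 0 \<sigma> \<and> (\<forall>x\<in>branches T. follows 0 \<sigma> x \<longrightarrow>
      (\<forall>n. initial_segment x n \<in> W \<and> R (initial_segment x n) (initial_segment x (Suc n))))"
    proof (rule strategy_for_step_relation[OF pruned])
      show "[] \<in> W" using True by (simp add: W_def g_def)
      fix s assume "s \<in> W"
      then have "s \<in> lfp (h (lfp_rank g s))"
        using in_step_lfp_rank[OF g] by (simp add: W_def g_lfp)
      then have "s \<in> h (lfp_rank g s) (lfp_rank (h (lfp_rank g s)) s)"
        by (rule in_step_lfp_rank[OF h])
      then have s: "s \<in> controllable T 0
          (by_event a b (lfp_rank g s) (g (lfp_rank g s)) (lfp_rank (h (lfp_rank g s)) s))"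
        by (simp add: h_def F_def)
      have sub: "lfp_rank (h (lfp_rank g s)) s \<subseteq> g (lfp_rank g s)"
        unfolding g_lfp by (rule stages_subset_lfp[OF h lfp_rank_in_stages])
      have "lfp_rank g s \<subseteq> W" unfolding W_def by (rule stages_subset_lfp[OF g lfp_rank_in_stages])
      then have "by_event a b (lfp_rank g s) (g (lfp_rank g s)) (lfp_rank (h (lfp_rank g s)) s)
          \<subseteq> {t \<in> W. R s t}"
        using sub W[of s] lfp_rank_step[OF g, of _ s] lfp_rank_less[OF g, of _ s]
        by (auto simp: by_event_def R_def subset_iff split: if_splits)
      from controllable_mono[OF this] s show "s \<in> controllable T 0 {t \<in> W. R s t}" by blast
    qed
    then obtain \<sigma> where strat: "strategy T 0 \<sigma>" and \<sigma>: "\<And>x n. x \<in> branches T \<Longrightarrow> follows 0 \<sigma> x \<Longrightarrow>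
       initial_segment x n \<in> W \<and> R (initial_segment x n) (initial_segment x (Suc n))"
      by blast
    have "x \<in> ?Win" if x: "x \<in> branches T" "follows 0 \<sigma> x" for x
    proof -
      define t where "t = initial_segment x"
      have R: "R (t n) (t (Suc n))" for n using \<sigma>[OF x] by (simp add: t_def)
      have "lfp_rank g (t (Suc n)) \<subseteq> lfp_rank g (t n)" for n
        using R[of n] by (auto simp: R_def split: if_splits)
      then have "\<forall>\<^sub>\<infinity>n. lfp_rank g (t (Suc n)) \<subseteq> lfp_rank g (t n)" by simp
      then obtain C where C: "\<forall>\<^sub>\<infinity>n. lfp_rank g (t n) = C"
        by (rule lfp_rank_eventually_constant[OF g])
      then obtain N where N: "\<And>n. n \<ge> N \<Longrightarrow> lfp_rank g (t n) = C" by (auto simp: MOST_nat_le)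
      have no_a: "\<not> a (t (Suc n))" if "n \<ge> N" for n
        using R[of n] N[of n] N[of "Suc n"] that by (auto simp: R_def)
      then have "\<forall>\<^sub>\<infinity>n. \<not> a (t (Suc n))" by (auto simp: MOST_nat_le)
      then have "\<forall>\<^sub>\<infinity>n. \<not> a (t n)" by (rule MOST_SucD)
      moreover have "\<exists>\<^sub>\<infinity>n. b (t n)"
      proof (rule ccontr)
        assume "\<not> (\<exists>\<^sub>\<infinity>n. b (t n))"
        then obtain M where M: "\<And>n. n \<ge> M \<Longrightarrow> \<not> b (t n)" by (auto simp: MOST_nat_le)
        have in_rank: "t (Suc n) \<in> lfp_rank (h C) (t n)" if "n \<ge> max M N" for n
          using R[of n] no_a[of n] M[of "Suc n"] N[of n] that by (auto simp: R_def)
        then have strict: "lfp_rank (h C) (t (Suc n)) \<subset> lfp_rank (h C) (t n)" if "n \<ge> max M N" for n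
          using lfp_rank_less[OF h] that by blast
        then have "\<forall>\<^sub>\<infinity>n. lfp_rank (h C) (t (Suc n)) \<subseteq> lfp_rank (h C) (t n)"
          unfolding MOST_nat_le by blast
        then obtain D where "\<forall>\<^sub>\<infinity>n. lfp_rank (h C) (t n) = D"
          by (rule lfp_rank_eventually_constant[OF h])
        then obtain K where "\<And>n. n \<ge> K \<Longrightarrow> lfp_rank (h C) (t n) = D" by (auto simp: MOST_nat_le)
        then show False using strict[of "max K (max M N)"] by simp
      qed
      ultimately show ?thesis using x(1) by (simp add: t_def)
    qed
    then show ?thesis using strat unfolding determined_def winning_strategy_def by blast
  next
    case False
    define k where "k = (\<lambda>X Y. gfp (\<lambda>Z. F 1 X Y Z))"
    define N where "N = gfp (\<lambda>X. lfp (k X))"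
    have "- lfp (\<lambda>X. gfp (\<lambda>Y. lfp (\<lambda>Z. F 0 X Y Z))) = N"
      by (simp add: N_def k_def Compl_lfp Compl_gfp Compl_F)
    then have root: "[] \<in> N" using False by blast
    have k: "mono (k X)" for X unfolding k_def by (intro monoI gfp_mono F_mono) auto
    have "mono (\<lambda>X. lfp (k X))" unfolding k_def
      by (intro monoI lfp_mono gfp_mono F_mono) auto
    from gfp_unfold[OF this] have N: "N = lfp (k N)" by (simp add: N_def)
    define r where "r = lfp_rank (k N)"
    have k_unfold: "k N Y = F 1 N Y (k N Y)" for Y
      unfolding k_def by (rule gfp_unfold) (intro monoI F_mono; auto)
    have kr: "k N (r s) \<subseteq> N" for s
      using monoD[OF k stages_subset_lfp[OF k lfp_rank_in_stages], of N N s]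
        lfp_unfold[OF k, of N] N
      by (simp add: r_def)
    \<comment> \<open>At an occurrence of \<open>a\<close> the rank may jump up again.\<close>
    define R where "R = (\<lambda>s t. a t \<or> (r t \<subseteq> r s \<and> (b t \<longrightarrow> r t \<subset> r s)))"
    have "\<exists>\<tau>. strategy T 1 \<tau> \<and> (\<forall>x\<in>branches T. follows 1 \<tau> x \<longrightarrow>
      (\<forall>n. initial_segment x n \<in> N \<and> R (initial_segment x n) (initial_segment x (Suc n))))"
    proof (rule strategy_for_step_relation[OF pruned root])
      fix s assume "s \<in> N"
      then have "s \<in> k N (r s)" using in_step_lfp_rank[OF k, of s] N by (simp add: r_def)
      then have s: "s \<in> controllable T 1 (by_event a b N (r s) (k N (r s)))"
        using k_unfold by (auto simp: F_def)
      have "r s \<subseteq> N"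
        using stages_subset_lfp[OF k lfp_rank_in_stages, of N s] N by (simp add: r_def)
      moreover have "r t \<subseteq> r s" if "t \<in> k N (r s)" for t
        using lfp_rank_step[OF k] that by (simp add: r_def)
      moreover have "r t \<subseteq> r s \<and> r t \<noteq> r s" if "t \<in> r s" for t
        using lfp_rank_less[OF k] that by (simp add: r_def psubset_eq)
      ultimately have "by_event a b N (r s) (k N (r s)) \<subseteq> {t \<in> N. R s t}"
        using kr[of s] unfolding by_event_def R_def psubset_eq
        by (intro subsetI) (simp split: if_splits; blast)
      from controllable_mono[OF this] s show "s \<in> controllable T 1 {t \<in> N. R s t}" by blast
    qed
    then obtain \<tau> where strat: "strategy T 1 \<tau>" and \<tau>: "\<And>x n. x \<in> branches T \<Longrightarrow> follows 1 \<tau> x \<Longrightarrow>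
       initial_segment x n \<in> N \<and> R (initial_segment x n) (initial_segment x (Suc n))"
      by blast
    have "x \<in> branches T - ?Win" if x: "x \<in> branches T" "follows 1 \<tau> x" for x
    proof -
      define t where "t = initial_segment x"
      have R: "R (t n) (t (Suc n))" for n using \<tau>[OF x] by (simp add: t_def)
      have "\<not> (\<exists>\<^sub>\<infinity>n. b (t n))" if "\<forall>\<^sub>\<infinity>n. \<not> a (t n)"
      proof -
        from that have "\<forall>\<^sub>\<infinity>n. \<not> a (t (Suc n))" by (rule MOST_SucI)
        then have step: "\<forall>\<^sub>\<infinity>n. r (t (Suc n)) \<subseteq> r (t n) \<and> (b (t (Suc n)) \<longrightarrow> r (t (Suc n)) \<subset> r (t n))"
          by (rule MOST_mono) (use R in \<open>auto simp: R_def\<close>)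
        then have "\<forall>\<^sub>\<infinity>n. r (t (Suc n)) \<subseteq> r (t n)" by (rule MOST_mono) blast
        then obtain C where "\<forall>\<^sub>\<infinity>n. r (t n) = C"
          unfolding r_def by (rule lfp_rank_eventually_constant[OF k])
        then have "\<forall>\<^sub>\<infinity>n. r (t n) = C \<and> r (t (Suc n)) = C"
          using MOST_SucI[where P = "\<lambda>n. r (t n) = C"] by (simp add: MOST_conj_distrib)
        from MOST_conjI[OF step this] have "\<forall>\<^sub>\<infinity>n. \<not> b (t (Suc n))"
          by (rule MOST_mono) auto
        then have "\<forall>\<^sub>\<infinity>n. \<not> b (t n)" by (rule MOST_SucD)
        then show ?thesis by simp
      qed
      then show ?thesis using x(1) unfolding t_def by blast
    qed
    then show ?thesis using strat unfolding determined_def winning_strategy_def by blast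
  qed
qed

section \<open>Turning countably many conditions into one recurring event\<close>

text \<open>
The counter stands at the number \<open>k\<close> of the first condition not yet acknowledged. At time \<open>n\<close> it
moves on if \<open>P k\<close> has been witnessed by then; so at most one condition is acknowledged at a time,
and infinitely many acknowledgements are needed for all of them.
\<close>
primrec counter :: "(nat \<Rightarrow> nat \<Rightarrow> bool) \<Rightarrow> nat \<Rightarrow> nat" where
  "counter P 0 = 0"
| "counter P (Suc n) = (if \<exists>i\<le>n. P (counter P n) i then Suc (counter P n) else counter P n)"

lemma counter_cong: "(\<And>k i. i < n \<Longrightarrow> P k i = P' k i) \<Longrightarrow> counter P n = counter P' n"
  by (induction n) (auto simp: less_Suc_eq_le)

lemma infinitely_often_counts_iff:
  "(\<exists>\<^sub>\<infinity>n. \<exists>i\<le>n. P (counter P n) i) \<longleftrightarrow> (\<forall>k. \<exists>i. P k i)"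
proof
  assume inf: "\<exists>\<^sub>\<infinity>n. \<exists>i\<le>n. P (counter P n) i"
  have reach: "\<exists>m. counter P m = counter P n \<and> (\<exists>i\<le>m. P (counter P m) i)" for n
  proof -
    obtain m where m: "m \<ge> n" "\<exists>i\<le>m. P (counter P m) i"
      using inf unfolding INFM_nat_le by blast
    then show ?thesis
    proof (induction rule: inc_induct)
      case (step n)
      then show ?case by (cases "\<exists>i\<le>n. P (counter P n) i") auto
    qed auto
  qed
  have "\<exists>n. counter P n = k" for k
  proof (induction k)
    case 0
    show ?case by (rule exI[of _ 0]) simp
  next
    case (Suc k)
    then obtain m where "counter P m = k" "\<exists>i\<le>m. P (counter P m) i" using reach by metis
    then have "counter P (Suc m) = Suc k" by simp
    then show ?case by blast
  qed
  then show "\<forall>k. \<exists>i. P k i" using reach by metis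
next
  assume all: "\<forall>k. \<exists>i. P k i"
  show "\<exists>\<^sub>\<infinity>n. \<exists>i\<le>n. P (counter P n) i"
  proof (rule ccontr)
    assume "\<not> ?thesis"
    then obtain N where N: "\<And>n. n \<ge> N \<Longrightarrow> \<not> (\<exists>i\<le>n. P (counter P n) i)"
      by (auto simp: INFM_nat_le)
    have const: "counter P n = counter P N" if "n \<ge> N" for n
      using that
    proof (induction rule: dec_induct)
      case (step n)
      then show ?case using N[of n] by (simp split: if_splits)
    qed simp
    obtain i where "P (counter P N) i" using all by blast
    then show False using N[of "max N i"] const[of "max N i"] by auto
  qed
qed

text \<open>
The counter at time \<open>n\<close> depends only on the first \<open>n\<close> moves, so its increments are an event
determined by the position.
\<close>
lemma infinitely_often_event:
  fixes Q :: "nat \<Rightarrow> 'm list \<Rightarrow> bool"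
  shows "\<exists>E. \<forall>x. (\<exists>\<^sub>\<infinity>n. E (initial_segment x n)) \<longleftrightarrow> (\<forall>k. \<exists>n. Q k (initial_segment x n))"
proof -
  define E where "E = (\<lambda>s. \<exists>i\<le>length s. Q (counter (\<lambda>k i. Q k (take i s)) (length s)) (take i s))"
  have E: "E (initial_segment x n) \<longleftrightarrow>
      (\<exists>i\<le>n. Q (counter (\<lambda>k i. Q k (initial_segment x i)) n) (initial_segment x i))" for x n
    unfolding E_def
    by (simp add: take_initial_segment cong: conj_cong)
      (subst counter_cong[of n _ "\<lambda>k i. Q k (initial_segment x i)"];
        simp add: take_initial_segment cong: conj_cong)
  show ?thesis
    by (intro exI[of _ E] allI)
      (simp only: E infinitely_often_counts_iff[of "\<lambda>k i. Q k (initial_segment x i)" for x])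
qed

section \<open>The graphs that remain possible\<close>

lemma topspace_graph_space [simp]: "topspace graph_space = Pow edges"
  by (auto simp: graph_space_def topspace_pullback_topology)

lemma openin_graph_space_edge:
  assumes "e \<in> edges"
  shows "openin graph_space {G. G \<subseteq> edges \<and> (e \<in> G \<longleftrightarrow> c)}"
proof -
  have "openin (product_topology (\<lambda>_. discrete_topology (UNIV :: bool set)) edges)
      {h \<in> topspace (product_topology (\<lambda>_. discrete_topology UNIV) edges). h e \<in> {c}}"
    by (rule openin_continuous_map_preimage[OF continuous_map_product_projection])
      (use assms in auto)
  moreover have "{G. G \<subseteq> edges \<and> (e \<in> G \<longleftrightarrow> c)} = (\<lambda>G. restrict (\<lambda>e. e \<in> G) edges) -`
      {h \<in> topspace (product_topology (\<lambda>_. discrete_topology UNIV) edges). h e \<in> {c}} \<inter> Pow edges"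
    using assms by auto
  ultimately show ?thesis
    unfolding graph_space_def openin_pullback_topology by blast
qed

text \<open>
The identification of graphs with characteristic functions has a continuous inverse, which carries
the compactness of the Cantor cube over.
\<close>
lemma compact_graph_space: "compact_space graph_space"
proof -
  let ?P = "product_topology (\<lambda>_. discrete_topology (UNIV :: bool set)) edges"
  let ?g = "\<lambda>h. {e \<in> edges. h e}"
  have "compact_space ?P"
    by (simp add: compact_space_product_topology compact_space_discrete_topology)
  moreover have "continuous_map ?P graph_space ?g"
    unfolding graph_space_def
  proof (rule continuous_map_pullback')
    show "continuous_map ?P ?P ((\<lambda>G. restrict (\<lambda>e. e \<in> G) edges) \<circ> ?g)"
      by (rule continuous_map_eq[OF continuous_map_id])
        (auto simp: fun_eq_iff PiE_iff extensional_def)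
  qed auto
  ultimately have "compactin graph_space (?g ` topspace ?P)"
    unfolding compact_space_def by (rule image_compactin)
  moreover have "?g ` topspace ?P = Pow edges"
  proof (intro equalityI subsetI)
    fix G assume "G \<in> Pow edges"
    then have "G = ?g (restrict (\<lambda>e. e \<in> G) edges)" by auto
    then show "G \<in> ?g ` topspace ?P"
      by (intro image_eqI[of _ ?g "restrict (\<lambda>e. e \<in> G) edges"]) auto
  qed auto
  ultimately show ?thesis by (simp add: compact_space_def)
qed

text \<open>
An answer is addressed by the number \<open>i\<close> of the turn instead of the edge, so that finitely many
answers belong to an initial segment.
\<close>
definition fits_answer :: "(nat \<Rightarrow> move) \<Rightarrow> nat set set \<Rightarrow> nat \<Rightarrow> bool" where
  "fits_answer x G i \<longleftrightarrow>
     (\<forall>e c. x (2 * i) = Edge e \<longrightarrow> x (2 * i + 1) = Colour c \<longrightarrow> (e \<in> G \<longleftrightarrow> c = Green))"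

definition compatible_graphs :: "move list \<Rightarrow> nat set set set" where
  "compatible_graphs s = {G. G \<subseteq> edges \<and> (\<forall>i. 2 * i + 1 < length s \<longrightarrow> fits_answer ((!) s) G i)}"

lemma run_edge_move:
  assumes "x \<in> runs"
  obtains e where "e \<in> edges" "x (2 * i) = Edge e"
proof -
  have "initial_segment x (Suc (2 * i)) \<in> game_tree" using assms by (auto simp: branches_def)
  then have "initial_segment x (Suc (2 * i)) ! (2 * i) \<in> Edge ` edges"
    unfolding game_tree_def by auto
  then show ?thesis using that by auto
qed

lemma run_colour_move:
  assumes "x \<in> runs"
  obtains c where "x (2 * i + 1) = Colour c"
proof -
  have "initial_segment x (2 * i + 2) \<in> game_tree" using assms by (auto simp: branches_def)
  then have "initial_segment x (2 * i + 2) ! (2 * i + 1) \<in> range Colour"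
    unfolding game_tree_def by auto
  then show ?thesis using that by auto
qed

lemma run_edges_distinct:
  assumes "x \<in> runs" "x (2 * i) = x (2 * j)"
  shows "i = j"
proof (rule ccontr)
  assume "i \<noteq> j"
  have "initial_segment x (Suc (2 * i + 2 * j)) \<in> game_tree"
    using assms by (auto simp: branches_def)
  then have "initial_segment x (Suc (2 * i + 2 * j)) ! (2 * i) \<noteq>
      initial_segment x (Suc (2 * i + 2 * j)) ! (2 * j)"
    unfolding game_tree_def using \<open>i \<noteq> j\<close> by auto
  then show False using assms(2) by simp
qed

text \<open>
Each edge is picked at most once in a run, so the green and the red edges are disjoint and
membership in the set of possible graphs amounts to one condition for each coloured edge.
\<close>
lemma possible_graphs_eq_fitting:
  assumes "x \<in> runs"
  shows "possible_graphs x = {G. G \<subseteq> edges \<and> (\<forall>i. fits_answer x G i)}" (is "_ = ?R")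
proof (intro equalityI subsetI)
  fix G assume "G \<in> possible_graphs x"
  then have G: "G \<subseteq> edges" "green_edges x \<subseteq> G" "G \<subseteq> green_edges x \<union> white_edges x"
    by (auto simp: possible_graphs_def)
  have disj: "green_edges x \<inter> red_edges x = {}"
  proof -
    have False if "x (2 * i) = Edge e" "x (2 * i + 1) = Colour Green"
      "x (2 * j) = Edge e" "x (2 * j + 1) = Colour Red" for e i j
      using run_edges_distinct[OF assms, of i j] that by simp
    then show ?thesis unfolding green_edges_def red_edges_def by blast
  qed
  have "e \<in> G \<longleftrightarrow> c = Green" if "x (2 * i) = Edge e" "x (2 * i + 1) = Colour c" for i e c
  proof (cases c)
    case Green
    then have "e \<in> green_edges x" using that by (auto simp: green_edges_def)
    then show ?thesis using Green G by auto
  next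
    case Red
    then have "e \<in> red_edges x" using that by (auto simp: red_edges_def)
    then show ?thesis using Red G disj by (auto simp: white_edges_def)
  qed
  then show "G \<in> ?R" using G(1) by (simp add: fits_answer_def)
next
  fix G assume G: "G \<in> ?R"
  then have "green_edges x \<subseteq> G" "G \<inter> red_edges x = {}"
    by (fastforce simp: green_edges_def red_edges_def fits_answer_def)+
  then show "G \<in> possible_graphs x" using G by (auto simp: possible_graphs_def white_edges_def)
qed

lemma compatible_graphs_initial_segment:
  "compatible_graphs (initial_segment x n) =
     {G. G \<subseteq> edges \<and> (\<forall>i. 2 * i + 1 < n \<longrightarrow> fits_answer x G i)}"
proof -
  have "fits_answer ((!) (initial_segment x n)) G i = fits_answer x G i" if "2 * i + 1 < n" for G i
    using that by (simp add: fits_answer_def)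
  then show ?thesis unfolding compatible_graphs_def length_initial_segment by blast
qed

text \<open>
If \<open>U\<close> contains all possible graphs, then \<open>U\<close> together with the open sets \<open>V i\<close> of graphs that
contradict the \<open>i\<close>-th answer of Hider covers the space. A finite subcover involves only finitely
many answers, and these already force the graph into \<open>U\<close>.
\<close>
lemma possible_graphs_subset_open_iff:
  assumes x: "x \<in> runs" and U: "openin graph_space U"
  shows "possible_graphs x \<subseteq> U \<longleftrightarrow> (\<exists>n. compatible_graphs (initial_segment x n) \<subseteq> U)"
proof
  assume sub: "possible_graphs x \<subseteq> U"
  define V where "V = (\<lambda>i. {G. G \<subseteq> edges \<and> \<not> fits_answer x G i})"
  have V: "openin graph_space (V i)" for i
  proof -
    obtain e where e: "e \<in> edges" "x (2 * i) = Edge e" using run_edge_move[OF x] .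
    obtain c where c: "x (2 * i + 1) = Colour c" using run_colour_move[OF x] .
    have "V i = {G. G \<subseteq> edges \<and> (e \<in> G \<longleftrightarrow> c \<noteq> Green)}"
      using e c by (simp add: V_def fits_answer_def)
    then show ?thesis using openin_graph_space_edge[OF e(1)] by simp
  qed
  have cover: "Pow edges \<subseteq> \<Union>(insert U (range V))"
  proof
    fix G assume G: "G \<in> Pow edges"
    show "G \<in> \<Union>(insert U (range V))"
    proof (cases "\<exists>i. G \<in> V i")
      case False
      then have "G \<in> possible_graphs x"
        using G by (simp add: possible_graphs_eq_fitting[OF x] V_def)
      then have "G \<in> U" using sub by (rule subsetD[rotated])
      then show ?thesis by simp
    qed simp
  qed
  have "compactin graph_space (Pow edges)"
    using compact_graph_space by (simp add: compact_space_def)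
  then have "\<exists>\<F>. finite \<F> \<and> \<F> \<subseteq> insert U (range V) \<and> Pow edges \<subseteq> \<Union>\<F>"
  proof (rule compactinD)
    show "openin graph_space W" if "W \<in> insert U (range V)" for W
      using that U V by (elim insertE imageE) simp_all
  qed (rule cover)
  then obtain \<F> where \<F>: "finite \<F>" "\<F> \<subseteq> insert U (range V)" "Pow edges \<subseteq> \<Union>\<F>"
    by blast
  then have "finite (\<F> - {U})" "\<F> - {U} \<subseteq> range V" by auto
  then obtain I where I: "finite I" "\<F> - {U} = V ` I"
    by (meson finite_subset_image)
  obtain m where m: "\<And>i. i \<in> I \<Longrightarrow> i < m"
    using I(1) by (metis finite_nat_set_iff_bounded)
  have "compatible_graphs (initial_segment x (2 * m)) \<subseteq> U"
  proof
    fix G assume G: "G \<in> compatible_graphs (initial_segment x (2 * m))"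
    have "G \<notin> V i" if "i \<in> I" for i
    proof -
      have "2 * i + 1 < 2 * m" using m[OF that] by simp
      then show ?thesis using G by (simp add: V_def compatible_graphs_initial_segment)
    qed
    then have "G \<notin> W" if "W \<in> \<F> - {U}" for W
      using that unfolding I(2) by (elim imageE) simp
    moreover have "G \<in> Pow edges" using G by (simp add: compatible_graphs_def)
    then obtain W where "W \<in> \<F>" "G \<in> W" using \<F>(3) by (elim subsetD[THEN UnionE])
    ultimately show "G \<in> U" by (cases "W = U") simp_all
  qed
  then show "\<exists>n. compatible_graphs (initial_segment x n) \<subseteq> U" ..
next
  assume "\<exists>n. compatible_graphs (initial_segment x n) \<subseteq> U"
  then obtain n where n: "compatible_graphs (initial_segment x n) \<subseteq> U" ..
  have "possible_graphs x \<subseteq> compatible_graphs (initial_segment x n)"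
    by (rule subsetI) (simp add: possible_graphs_eq_fitting[OF x] compatible_graphs_initial_segment)
  then show "possible_graphs x \<subseteq> U" using n by (rule subset_trans)
qed

section \<open>Seeker's winning set in terms of events\<close>

text \<open>
The \<open>G\<^sub>\<delta>\<close> set \<open>S\<close> is an intersection of open sets \<open>U k\<close>, and each inclusion in \<open>U k\<close> is
witnessed at a finite stage.
\<close>
lemma certainty_event:
  assumes "fsigma_in graph_space (Pow edges - S)" "S \<subseteq> Pow edges"
  shows "\<exists>b. \<forall>x\<in>runs. possible_graphs x \<subseteq> S \<longleftrightarrow> (\<exists>\<^sub>\<infinity>n. b (initial_segment x n))"
proof -
  obtain C where C: "\<And>k::nat. closedin graph_space (C k)" "\<Union>(range C) = Pow edges - S"
    using assms(1) unfolding fsigma_in_ascending by auto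
  define U where "U = (\<lambda>k. Pow edges - C k)"
  have U: "openin graph_space (U k)" for k
    using C(1)[of k] by (simp add: closedin_def U_def)
  have S: "S = (\<Inter>k. U k)" using C(2) assms(2) by (auto simp: U_def)
  obtain b where b: "\<And>x. (\<exists>\<^sub>\<infinity>n. b (initial_segment x n)) \<longleftrightarrow>
      (\<forall>k. \<exists>n. compatible_graphs (initial_segment x n) \<subseteq> U k)"
    using infinitely_often_event[of "\<lambda>k s. compatible_graphs s \<subseteq> U k"] by blast
  have "possible_graphs x \<subseteq> S \<longleftrightarrow> (\<exists>\<^sub>\<infinity>n. b (initial_segment x n))" if "x \<in> runs" for x
    unfolding b possible_graphs_subset_open_iff[OF that U, symmetric] S by blast
  then show ?thesis by blast
qed

text \<open>
The conditions counted are that the \<open>k\<close>-th edge of a fixed enumeration has been picked; all of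
them are met exactly if no edge stays white.
\<close>
lemma white_event:
  "\<exists>a. \<forall>x\<in>runs. white_edges x \<noteq> {} \<longleftrightarrow> (\<forall>\<^sub>\<infinity>n. \<not> a (initial_segment x n))"
proof -
  have "countable edges"
  proof (rule countable_subset)
    show "edges \<subseteq> range (\<lambda>p. {fst p, snd p})"
    proof
      fix e assume "e \<in> edges"
      then obtain n k where "e = {n, k}" unfolding edges_def by blast
      then have "e = (\<lambda>p. {fst p, snd p}) (n, k)" by simp
      then show "e \<in> range (\<lambda>p. {fst p, snd p})" by (rule range_eqI)
    qed
  qed simp
  moreover have "edges \<noteq> {}" unfolding edges_def using zero_neq_one by blast
  ultimately obtain en :: "nat \<Rightarrow> nat set" where en: "range en = edges"
    using range_from_nat_into by metis
  obtain a where a: "\<And>x. (\<exists>\<^sub>\<infinity>n. a (initial_segment x n)) \<longleftrightarrow>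
      (\<forall>k. \<exists>n. Edge (en k) \<in> set (initial_segment x n))"
    using infinitely_often_event[of "\<lambda>k s. Edge (en k) \<in> set s"] by blast
  have "white_edges x = {} \<longleftrightarrow> (\<exists>\<^sub>\<infinity>n. a (initial_segment x n))" if x: "x \<in> runs" for x
  proof -
    have "e \<in> green_edges x \<union> red_edges x \<longleftrightarrow> (\<exists>n. Edge e \<in> set (initial_segment x n))" for e
    proof
      assume "\<exists>n. Edge e \<in> set (initial_segment x n)"
      then obtain j where j: "x j = Edge e" by (auto simp: initial_segment_def)
      show "e \<in> green_edges x \<union> red_edges x"
      proof (cases "even j")
        case True
        then obtain i where i: "j = 2 * i" by blast
        obtain c where "x (2 * i + 1) = Colour c" using run_colour_move[OF x] .
        then show ?thesis using i j by (cases c) (auto simp: green_edges_def red_edges_def)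
      next
        case False
        then obtain i where "j = 2 * i + 1" by (rule oddE)
        then show ?thesis using j run_colour_move[OF x, of i] by auto
      qed
    next
      assume "e \<in> green_edges x \<union> red_edges x"
      then obtain i where "x (2 * i) = Edge e" by (auto simp: green_edges_def red_edges_def)
      then have "Edge e \<in> set (initial_segment x (Suc (2 * i)))" by (simp add: initial_segment_Suc)
      then show "\<exists>n. Edge e \<in> set (initial_segment x n)" ..
    qed
    then have "white_edges x = {} \<longleftrightarrow> (\<forall>e\<in>range en. \<exists>n. Edge e \<in> set (initial_segment x n))"
      unfolding white_edges_def en by blast
    then show ?thesis unfolding a by simp
  qed
  then have "\<forall>x\<in>runs. white_edges x \<noteq> {} \<longleftrightarrow> (\<forall>\<^sub>\<infinity>n. \<not> a (initial_segment x n))" by simp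
  then show ?thesis by blast
qed

lemma seeker_wins_events:
  assumes "delta0 graph_space 2 S"
  shows "\<exists>a b. seeker_wins S = {x \<in> runs.
    (\<forall>\<^sub>\<infinity>n. \<not> a (initial_segment x n)) \<and> (\<exists>\<^sub>\<infinity>n. b (initial_segment x n))}"
proof -
  have S: "S \<subseteq> Pow edges" "fsigma_in graph_space S" "fsigma_in graph_space (Pow edges - S)"
    using assms unfolding delta0_def pi0_def sigma0_2_iff by auto
  then have compl: "fsigma_in graph_space (Pow edges - (Pow edges - S))"
    by (simp add: double_diff)
  obtain a where a: "\<And>x. x \<in> runs \<Longrightarrow> white_edges x \<noteq> {} \<longleftrightarrow> (\<forall>\<^sub>\<infinity>n. \<not> a (initial_segment x n))"
    using white_event by blast
  obtain b1 where b1: "\<And>x. x \<in> runs \<Longrightarrow> possible_graphs x \<subseteq> S \<longleftrightarrow> (\<exists>\<^sub>\<infinity>n. b1 (initial_segment x n))"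
    using certainty_event[OF S(3,1)] by blast
  obtain b2 where b2: "\<forall>x\<in>runs. possible_graphs x \<subseteq> Pow edges - S \<longleftrightarrow>
      (\<exists>\<^sub>\<infinity>n. b2 (initial_segment x n))"
    using certainty_event[OF compl Diff_subset] ..
  have "white_edges x \<noteq> {} \<and> (possible_graphs x \<subseteq> S \<or> possible_graphs x \<subseteq> Pow edges - S)
      \<longleftrightarrow> (\<forall>\<^sub>\<infinity>n. \<not> a (initial_segment x n)) \<and>
        (\<exists>\<^sub>\<infinity>n. b1 (initial_segment x n) \<or> b2 (initial_segment x n))" if x: "x \<in> runs" for x
    unfolding INFM_disj_distrib
    by (intro arg_cong2[where f = "(\<and>)"] arg_cong2[where f = "(\<or>)"] a[OF x] b1[OF x] bspec[OF b2 x])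
  then have "seeker_wins S = {x \<in> runs. (\<forall>\<^sub>\<infinity>n. \<not> a (initial_segment x n)) \<and>
      (\<exists>\<^sub>\<infinity>n. b1 (initial_segment x n) \<or> b2 (initial_segment x n))}"
    unfolding seeker_wins_def by (rule Collect_cong[OF conj_cong[OF refl]])
  then show ?thesis by (intro exI)
qed

section \<open>The Borel class of a condition on events\<close>

lemma topspace_run_space [simp]: "topspace run_space = runs"
proof -
  have "x n \<in> moves" if "x \<in> runs" for x n
  proof -
    have "initial_segment x (Suc n) \<in> lists moves"
      using that by (auto simp: branches_def game_tree_def)
    then show ?thesis by (simp add: initial_segment_Suc)
  qed
  then show ?thesis by (auto simp: run_space_def)
qed

lemma openin_run_space_event:
  "openin run_space {x \<in> runs. \<exists>n. Q n (initial_segment x n)}"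
proof -
  let ?P = "product_topology (\<lambda>_::nat. discrete_topology moves) UNIV"
  have "\<exists>U. openin run_space U \<and> y \<in> U \<and> U \<subseteq> {x \<in> runs. \<exists>n. Q n (initial_segment x n)}"
    if y: "y \<in> runs" "Q n (initial_segment y n)" for y n
  proof -
    define B where "B = (\<Pi>\<^sub>E i\<in>(UNIV :: nat set). if i < n then {y i} else moves)"
    have ym: "y i \<in> moves" for i
      using y(1) topspace_run_space by (auto simp: run_space_def PiE_iff)
    have "finite {i. (if i < n then {y i} else moves) \<noteq> topspace (discrete_topology moves)}"
      by (rule finite_subset[of _ "{..<n}"]) auto
    then have "openin ?P B" unfolding B_def
      by (intro product_topology_basis) (use ym in auto)
    then have "openin run_space (B \<inter> runs)"
      unfolding run_space_def by (simp add: openin_subtopology_Int)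
    moreover have "y \<in> B \<inter> runs" using y(1) ym by (auto simp: B_def)
    moreover have "B \<inter> runs \<subseteq> {x \<in> runs. \<exists>n. Q n (initial_segment x n)}"
    proof
      fix x assume x: "x \<in> B \<inter> runs"
      then have "initial_segment x n = initial_segment y n"
        by (auto simp: B_def initial_segment_def PiE_iff split: if_splits)
      then have "Q n (initial_segment x n)" using y(2) by simp
      then show "x \<in> {x \<in> runs. \<exists>n. Q n (initial_segment x n)}" using x by blast
    qed
    ultimately show ?thesis by blast
  qed
  then show ?thesis by (subst openin_subopen) blast
qed

text \<open>
The complement is the union of a \<open>G\<^sub>\<delta>\<close> set (infinitely many \<open>a\<close>), put at index \<open>0\<close>, and of
countably many closed sets (no \<open>b\<close> from time \<open>j\<close> on), put at the indices \<open>Suc j\<close>.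
\<close>
lemma pi0_3_events:
  "pi0 run_space 3 {x \<in> runs.
    (\<forall>\<^sub>\<infinity>n. \<not> a (initial_segment x n)) \<and> (\<exists>\<^sub>\<infinity>n. b (initial_segment x n))}"
    (is "pi0 _ _ ?B")
proof -
  define A where "A = (\<lambda>k. case k of 0 \<Rightarrow> {x \<in> runs. \<exists>\<^sub>\<infinity>n. a (initial_segment x n)}
    | Suc j \<Rightarrow> {x \<in> runs. \<forall>n\<ge>j. \<not> b (initial_segment x n)})"
  define m :: "nat \<Rightarrow> nat" where "m = (\<lambda>k. case k of 0 \<Rightarrow> 2 | Suc _ \<Rightarrow> 1)"
  have "sigma0 run_space 2 (\<Union>j. {x \<in> runs. \<forall>n\<ge>j. \<not> a (initial_segment x n)})"
  proof (rule sigma0_Union[where m = "\<lambda>_. 1"], simp, intro allI conjI)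
    fix j
    have "runs - {x \<in> runs. \<forall>n\<ge>j. \<not> a (initial_segment x n)} =
        {x \<in> runs. \<exists>n. n \<ge> j \<and> a (initial_segment x n)}" by auto
    then show "sigma0 run_space 1
        (topspace run_space - {x \<in> runs. \<forall>n\<ge>j. \<not> a (initial_segment x n)})"
      using openin_run_space_event[of "\<lambda>n s. n \<ge> j \<and> a s"]
      by (simp only: sigma0_1_iff topspace_run_space)
  qed auto
  moreover have "(\<Union>j. {x \<in> runs. \<forall>n\<ge>j. \<not> a (initial_segment x n)}) = topspace run_space - A 0"
    by (auto simp: A_def INFM_nat_le)
  ultimately have A0: "sigma0 run_space 2 (topspace run_space - A 0)" by simp
  have ASuc: "sigma0 run_space 1 (topspace run_space - A (Suc j))" for j
  proof -
    have "runs - A (Suc j) = {x \<in> runs. \<exists>n. n \<ge> j \<and> b (initial_segment x n)}"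
      by (auto simp: A_def)
    then show ?thesis
      using openin_run_space_event[of "\<lambda>n s. n \<ge> j \<and> b s"]
      by (simp only: sigma0_1_iff topspace_run_space)
  qed
  have "sigma0 run_space 3 (\<Union>k. A k)"
  proof (rule sigma0_Union[where m = m], simp, intro allI)
    fix k
    show "1 \<le> m k \<and> m k < 3 \<and> A k \<subseteq> topspace run_space \<and>
        sigma0 run_space (m k) (topspace run_space - A k)"
      by (cases k) (use A0 ASuc in \<open>auto simp: m_def A_def\<close>)
  qed
  moreover have "(\<Union>k. A k) = topspace run_space - ?B"
  proof -
    have "(\<Union>k. A k) = A 0 \<union> (\<Union>j. A (Suc j))"
      by (metis UN_insert UNIV_nat_eq image_image)
    then show ?thesis by (auto simp: A_def INFM_nat_le MOST_nat_le)
  qed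
  ultimately show ?thesis unfolding pi0_def by auto
qed

section \<open>The game on graphs\<close>

text \<open>
The game never gets stuck: there are infinitely many edges, so Seeker always finds a fresh one.
\<close>
lemma game_tree_pruned:
  assumes "s \<in> game_tree"
  shows "\<exists>m. s @ [m] \<in> game_tree"
proof (cases "even (length s)")
  case True
  have "infinite edges"
  proof
    assume "finite edges"
    moreover have "(\<lambda>n. {0, Suc n}) ` UNIV \<subseteq> edges" by (auto simp: edges_def)
    ultimately have "finite ((\<lambda>n::nat. {0, Suc n}) ` UNIV)" by (rule rev_finite_subset)
    then show False
      by (rule finite_imageD[THEN infinite_UNIV_nat[THEN notE]])
        (auto simp: inj_on_def doubleton_eq_iff)
  qed
  then have "infinite (Edge ` edges)" by (simp add: finite_image_iff inj_on_def)
  then obtain m where m: "m \<in> Edge ` edges" "m \<notin> set s"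
    by (meson List.finite_set finite_subset subsetI)
  have "Suc (2 * i) \<noteq> length s" for i using True by presburger
  then have "s @ [m] \<in> game_tree"
    using assms m unfolding game_tree_def
    by (auto simp: moves_def nth_append less_Suc_eq in_set_conv_nth)
  then show ?thesis ..
next
  case False
  have "2 * i \<noteq> length s" for i using False by presburger
  then have "s @ [Colour Green] \<in> game_tree"
    using assms unfolding game_tree_def
    by (auto simp: moves_def nth_append less_Suc_eq)
  then show ?thesis ..
qed

theorem theorem6p6:
  fixes S :: "nat set set set"
  assumes "graph_property S"
    and "delta0 graph_space 2 S"
  shows "pi0 run_space 3 (seeker_wins S) \<and> determined game_tree (seeker_wins S)"
proof -
  obtain a b where "seeker_wins S = {x \<in> runs.
      (\<forall>\<^sub>\<infinity>n. \<not> a (initial_segment x n)) \<and> (\<exists>\<^sub>\<infinity>n. b (initial_segment x n))}"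
    using seeker_wins_events[OF assms(2)] by blast
  then show ?thesis
    using pi0_3_events[of a b] three_event_game_determined[OF game_tree_pruned, of a b] by metis
qed

end
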